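(* Let $m\ge1$ and $\theta>1$, and assume that one of the following holds: (a) $\theta\ge2$ and $f\in W^{1,\infty}_{\mathrm{loc}}(\mathbb{R}^m)$ is coercive, i.e. $f(x)\to+\infty$ as $|x|\to+\infty$; or (b) $1<\theta<2$ and $f$ satisfies assumptions (H0) and (H1) recalled in the context. If $(\lambda,\phi)$ is a solution of $(EP)$ with $\phi$ bounded from below, then $\lambda=\lambda^*$, where $$\lambda^*:=\sup\{\mu\in\mathbb{R}\;:\;(EP)_\mu\text{ has a subsolution}\}.$$
   Context: For $\lambda\in\mathbb{R}$, $(EP)_\lambda$ denotes the equation $-\frac12\Delta\phi(y)+\frac1\theta|D\phi(y)|^\theta=f(y)-\lambda$ in $\mathbb{R}^m$. A solution (resp. subsolution) of $(EP)_\lambda$ is a function $\phi\in C^2(\mathbb{R}^m)$ satisfying the equation (resp. with $=$ replaced by $\le$) at every point. A pair $(\lambda,\phi)$ is a solution of $(EP)$ if $\phi$ is a solution of $(EP)_\lambda$. $W^{1,\infty}_{\mathrm{loc}}(\mathbb{R}^m)$ is identified with the space of locally Lipschitz continuous functions. Assumptions, with common constants $\alpha>0$ and $f_0>0$: (H0) $f\in W^{1,\infty}_{\mathrm{loc}}(\mathbb{R}^m)$ is bounded from below and, for (almost) all $y\in\mathbb{R}^m$, $|Df(y)|\le f_0(1+|y|^{\alpha-1})$ if $\alpha\ge1$, or $|Df(y)|\le f_0$ if $\alpha<1$. (H1) $f_0^{-1}(|y|^\alpha+1)\le f(y)\le f_0(|y|^\alpha+1)$ for all $y\in\mathbb{R}^m$.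 *)

theory Defs
  imports "HOL-Analysis.Analysis"
begin

text \<open>
  \<^term>\<open>frechet_derivative\<close> is unspecified at points where the function is not
  differentiable, so the two operators below are only meaningful together with an
  explicit differentiability condition; every use of them below carries one.
\<close>

definition grad :: "('a::euclidean_space \<Rightarrow> real) \<Rightarrow> 'a \<Rightarrow> 'a" where
  "grad \<phi> y = (\<Sum>b\<in>Basis. frechet_derivative \<phi> (at y) b *\<^sub>R b)"

definition laplacian :: "('a::euclidean_space \<Rightarrow> real) \<Rightarrow> 'a \<Rightarrow> real" where
  "laplacian \<phi> y = (\<Sum>b\<in>Basis. frechet_derivative (grad \<phi>) (at y) b \<bullet> b)"

text \<open>
  The map \<open>y \<mapsto> frechet_derivative (grad \<phi>) (at y) b\<close> is the column of the Hessian of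
  \<open>\<phi>\<close> in direction \<open>b\<close>, so the last conjunct is continuity of all second partial
  derivatives.
\<close>

definition C2 :: "('a::euclidean_space \<Rightarrow> real) \<Rightarrow> bool" where
  "C2 \<phi> \<longleftrightarrow>
     (\<forall>y. \<phi> differentiable at y) \<and>
     (\<forall>y. grad \<phi> differentiable at y) \<and>
     (\<forall>b\<in>Basis. continuous_on UNIV (\<lambda>y. frechet_derivative (grad \<phi>) (at y) b))"

definition EP_solution ::
    "real \<Rightarrow> ('a::euclidean_space \<Rightarrow> real) \<Rightarrow> real \<Rightarrow> ('a \<Rightarrow> real) \<Rightarrow> bool" where
  "EP_solution \<theta> f \<mu> \<phi> \<longleftrightarrow> C2 \<phi> \<and>
     (\<forall>y. - (1/2) * laplacian \<phi> y + (1/\<theta>) * norm (grad \<phi> y) powr \<theta> = f y - \<mu>)"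

definition EP_subsolution ::
    "real \<Rightarrow> ('a::euclidean_space \<Rightarrow> real) \<Rightarrow> real \<Rightarrow> ('a \<Rightarrow> real) \<Rightarrow> bool" where
  "EP_subsolution \<theta> f \<mu> \<phi> \<longleftrightarrow> C2 \<phi> \<and>
     (\<forall>y. - (1/2) * laplacian \<phi> y + (1/\<theta>) * norm (grad \<phi> y) powr \<theta> \<le> f y - \<mu>)"

text \<open>
  The supremum is taken in the extended reals, because \<open>Sup\<close> on \<^typ>\<open>real\<close> is unspecified
  for empty or unbounded sets.
\<close>

definition lambda_star :: "real \<Rightarrow> ('a::euclidean_space \<Rightarrow> real) \<Rightarrow> ereal" where
  "lambda_star \<theta> f = Sup (ereal ` {\<mu>. \<exists>\<phi>. EP_subsolution \<theta> f \<mu> \<phi>})"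

definition locally_lipschitz :: "('a::euclidean_space \<Rightarrow> real) \<Rightarrow> bool" where
  "locally_lipschitz f \<longleftrightarrow> (\<forall>x. \<exists>r>0. \<exists>L. L-lipschitz_on (cball x r) f)"

definition coercive :: "('a::euclidean_space \<Rightarrow> real) \<Rightarrow> bool" where
  "coercive f \<longleftrightarrow> filterlim f at_top at_infinity"

text \<open>
  A locally Lipschitz function is differentiable almost everywhere (Rademacher), and its
  weak gradient is its pointwise gradient there; the differentiability conjunct only
  guards the use of \<^term>\<open>grad\<close>. The convention \<open>0 powr 0 = 0\<close> matters only for
  \<open>\<alpha> = 1\<close> at the single point \<open>y = 0\<close>, a null set.
\<close>

definition H0 :: "real \<Rightarrow> real \<Rightarrow> ('a::euclidean_space \<Rightarrow> real) \<Rightarrow> bool" where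
  "H0 \<alpha> f0 f \<longleftrightarrow>
     locally_lipschitz f \<and> bdd_below (range f) \<and>
     (AE y in lborel. f differentiable at y \<and>
        norm (grad f y) \<le> (if \<alpha> \<ge> 1 then f0 * (1 + norm y powr (\<alpha> - 1)) else f0))"

definition H1 :: "real \<Rightarrow> real \<Rightarrow> ('a::euclidean_space \<Rightarrow> real) \<Rightarrow> bool" where
  "H1 \<alpha> f0 f \<longleftrightarrow>
     (\<forall>y. inverse f0 * (norm y powr \<alpha> + 1) \<le> f y \<and> f y \<le> f0 * (norm y powr \<alpha> + 1))"

end

theory Submission imports Defs begin

text \<open>
  A solution is a subsolution, so the point is that a subsolution \<open>\<psi>\<close> at level \<open>\<mu>\<close> forces
  \<open>\<mu> \<le> lam\<close>. If \<open>\<psi> - \<phi>\<close> had a global maximum, the two equations compared at that point would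
  give \<open>f - lam \<le> f - \<mu>\<close>, which is the claim. The difficulty is to prevent maximising sequences
  from escaping to infinity, since nothing is known about \<open>\<psi>\<close> there. Every argument below is a
  maximum principle for twice differentiable functions.

  For \<open>\<theta> \<ge> 2\<close> the unknowns are replaced by \<open>exp (- \<phi>)\<close> and \<open>exp (- \<psi>)\<close>. The lower bound on \<open>\<phi>\<close>
  and the coercivity of \<open>f\<close> make \<open>\<phi>\<close> tend to infinity (\<open>solution_tends_to_infinity\<close>), so
  \<open>exp (- \<phi>)\<close> vanishes at infinity while \<open>exp (- \<psi>)\<close> is positive: a positive supremum of
  \<open>exp (- \<phi>) - exp (- \<psi>)\<close> is attained. The change of unknown produces a term \<open>|D\<phi>|\<^sup>2\<close>,
  which \<open>|D\<phi>|\<^sup>\<theta>\<close> absorbs exactly because \<open>\<theta> \<ge> 2\<close> (\<open>exponential_transform_gap\<close>). Hence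
  the maximum cannot lie where \<open>f\<close> is large, so that \<open>\<psi> - \<phi>\<close> is maximal inside a fixed ball.

  For \<open>\<theta> < 2\<close> this absorption fails and the growth of \<open>f\<close> is used instead. Put
  \<open>\<gamma> = \<alpha> / \<theta> + 1\<close>, the exponent that balances \<open>|D\<phi>|\<^sup>\<theta>\<close> against \<open>|y|\<^sup>\<alpha>\<close>. A barrier that blows
  up on a sphere bounds every subsolution by \<open>C * (1 + |y|\<^sup>\<gamma>)\<close> (\<open>subsolution_growth\<close>). Next,
  for \<open>\<rho> > 1\<close> the multiple \<open>\<rho> * \<phi>\<close> is a strict supersolution, with a margin \<open>(\<rho> - 1) * f\<close> large
  enough to pay for subtracting the paraboloid \<open>\<sigma> * R\<^sup>\<gamma>\<^sup>-\<^sup>2 * |y - x|\<^sup>2\<close> on a ball of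
  radius \<open>R\<close> at distance \<open>2 * R\<close> from the origin. So a bound \<open>\<psi> - \<rho> * \<phi> \<le> B\<close> improves itself
  to \<open>\<psi> - \<rho> * \<phi> \<le> B' - \<sigma> * |y|\<^sup>\<gamma>\<close> (\<open>comparison_gains_growth\<close>). With \<open>\<psi> = 0\<close> this gives
  the matching lower bound on \<open>\<phi>\<close>; with the upper bound on \<open>\<phi>\<close> it lets \<open>\<rho>\<close> decrease by a fixed
  amount, and so brings \<open>\<rho>\<close> arbitrarily close to \<open>1\<close>. For each \<open>\<rho> > 1\<close> the maximum of
  \<open>\<psi> - \<rho> * \<phi>\<close> is then attained and yields \<open>\<mu> \<le> \<rho> * lam\<close>. The convexity inequality
  \<open>powr_norm_convex_split\<close> is what makes this work without a bound on the gradient of \<open>\<phi>\<close>.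
\<close>

section \<open>First and second order conditions at a maximum\<close>

lemma has_derivative_grad:
  assumes "\<phi> differentiable at y"
  shows "(\<phi> has_derivative (\<lambda>v. grad \<phi> y \<bullet> v)) (at y)"
proof -
  let ?D = "frechet_derivative \<phi> (at y)"
  have D: "(\<phi> has_derivative ?D) (at y)"
    using assms by (simp add: frechet_derivative_works)
  interpret linear ?D
    using D by (rule has_derivative_linear)
  have "?D v = grad \<phi> y \<bullet> v" for v
  proof -
    have "?D v = ?D (\<Sum>b\<in>Basis. (v \<bullet> b) *\<^sub>R b)"
      by (simp add: euclidean_representation)
    also have "\<dots> = (\<Sum>b\<in>Basis. (v \<bullet> b) * ?D b)"
      by (simp add: sum scale)
    also have "\<dots> = grad \<phi> y \<bullet> v"
      by (simp add: grad_def inner_sum_right inner_commute[of _ v] mult.commute)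
    finally show ?thesis .
  qed
  then show ?thesis
    using D by (metis (no_types, lifting) ext)
qed

lemma C2D:
  assumes "C2 \<phi>"
  shows "(\<phi> has_derivative (\<lambda>v. grad \<phi> y \<bullet> v)) (at y)"
    and "(grad \<phi> has_derivative frechet_derivative (grad \<phi>) (at y)) (at y)"
    and "continuous_on S \<phi>"
proof -
  show *: "(\<phi> has_derivative (\<lambda>v. grad \<phi> y \<bullet> v)) (at y)" for y
    using assms by (auto simp: C2_def intro: has_derivative_grad)
  show "(grad \<phi> has_derivative frechet_derivative (grad \<phi>) (at y)) (at y)"
    using assms by (auto simp: C2_def frechet_derivative_works)
  show "continuous_on S \<phi>"
    using * by (meson continuous_at_imp_continuous_on has_derivative_continuous)
qed

text \<open>
  Along a line in a direction \<open>b\<close> with \<open>H b \<bullet> b > 0\<close>, the derivative of \<open>u\<close> would vanish at \<open>x\<close>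
  and be positive just after it, so that \<open>u\<close> would exceed its maximum.
\<close>

lemma local_max_second_order:
  fixes u :: "'a::euclidean_space \<Rightarrow> real"
  assumes "open S" "x \<in> S"
    and u: "\<And>y. y \<in> S \<Longrightarrow> (u has_derivative (\<lambda>v. G y \<bullet> v)) (at y)"
    and G: "(G has_derivative H) (at x)"
    and max: "\<And>y. y \<in> S \<Longrightarrow> u y \<le> u x"
  shows "G x = 0" and "(\<Sum>b\<in>Basis. H b \<bullet> b) \<le> 0"
proof -
  have "(\<lambda>v. G x \<bullet> v) = (\<lambda>v. 0)"
    by (rule differential_zero_maxmin[OF assms(2,1) u]) (use assms in auto)
  then show G0: "G x = 0"
    by (metis inner_eq_zero_iff)
  have "H b \<bullet> b \<le> 0" if "b \<in> Basis" for b
  proof (rule ccontr)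
    assume "\<not> H b \<bullet> b \<le> 0"
    then have pos: "H b \<bullet> b > 0" by simp
    interpret H: linear H using G by (rule has_derivative_linear)
    have line: "((\<lambda>t. x + t *\<^sub>R b) has_derivative (\<lambda>h. h *\<^sub>R b)) (at t)" for t
      by (auto intro!: derivative_eq_intros)
    have du: "((\<lambda>t. u (x + t *\<^sub>R b)) has_real_derivative G (x + t *\<^sub>R b) \<bullet> b) (at t)"
      if "x + t *\<^sub>R b \<in> S" for t
      using has_derivative_compose[OF line[of t] u[OF that]]
      by (simp add: has_field_derivative_def mult_commute_abs)
    have "((\<lambda>t. G (x + t *\<^sub>R b)) has_derivative (\<lambda>h. H (h *\<^sub>R b))) (at 0)"
      using has_derivative_compose[OF line[of 0], of G H] G by simp
    then have "((\<lambda>t. G (x + t *\<^sub>R b) \<bullet> b) has_derivative (\<lambda>h. H (h *\<^sub>R b) \<bullet> b)) (at 0)"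
      by (auto intro!: derivative_eq_intros)
    then have "((\<lambda>t. G (x + t *\<^sub>R b) \<bullet> b) has_real_derivative H b \<bullet> b) (at 0)"
      by (simp add: has_field_derivative_def H.scale mult_commute_abs)
    from DERIV_pos_inc_right[OF this pos] obtain d where d: "d > 0"
      "\<And>h. 0 < h \<Longrightarrow> h < d \<Longrightarrow> G (x + h *\<^sub>R b) \<bullet> b > 0"
      using G0 by auto
    obtain e where e: "e > 0" "ball x e \<subseteq> S"
      using assms(1,2) openE by blast
    define k where "k = min d e / 2"
    have k: "0 < k" "k < d" "k < e" using d e by (auto simp: k_def)
    have inS: "x + t *\<^sub>R b \<in> S" if "0 \<le> t" "t \<le> k" for t
      using that k e \<open>b \<in> Basis\<close> by (intro subsetD[OF e(2)]) (simp add: dist_norm)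
    obtain z where z: "0 < z" "z < k"
      "u (x + k *\<^sub>R b) - u (x + 0 *\<^sub>R b) = (k - 0) * (G (x + z *\<^sub>R b) \<bullet> b)"
      using MVT2[OF k(1), of "\<lambda>t. u (x + t *\<^sub>R b)" "\<lambda>t. G (x + t *\<^sub>R b) \<bullet> b"] du inS
      by auto
    have "(k - 0) * (G (x + z *\<^sub>R b) \<bullet> b) > 0"
      using d(2)[of z] z k by simp
    then have "u (x + k *\<^sub>R b) > u x" using z by simp
    then show False using max[OF inS[of k]] k by simp
  qed
  then show "(\<Sum>b\<in>Basis. H b \<bullet> b) \<le> 0"
    by (intro sum_nonpos) auto
qed

text \<open>
  The form in which maxima are used throughout: \<open>\<rho> * \<phi> + g\<close> touches \<open>\<psi>\<close> from above, with an
  explicit perturbation or barrier \<open>g\<close> given by its gradient field \<open>G\<close> and the derivative \<open>H\<close>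
  of that field at the point of contact.
\<close>

lemma C2_local_max_test:
  assumes "C2 \<psi>" "C2 \<phi>" "open S" "x \<in> S"
    and g: "\<And>y. y \<in> S \<Longrightarrow> (g has_derivative (\<lambda>v. G y \<bullet> v)) (at y)"
    and G: "(G has_derivative H) (at x)"
    and max: "\<And>y. y \<in> S \<Longrightarrow> \<psi> y - \<rho> * \<phi> y - g y \<le> \<psi> x - \<rho> * \<phi> x - g x"
  shows "grad \<psi> x = \<rho> *\<^sub>R grad \<phi> x + G x"
    and "laplacian \<psi> x \<le> \<rho> * laplacian \<phi> x + (\<Sum>b\<in>Basis. H b \<bullet> b)"
proof -
  let ?u = "\<lambda>y. \<psi> y - \<rho> * \<phi> y - g y"
  let ?G = "\<lambda>y. grad \<psi> y - \<rho> *\<^sub>R grad \<phi> y - G y"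
  let ?H = "\<lambda>v. frechet_derivative (grad \<psi>) (at x) v
      - \<rho> *\<^sub>R frechet_derivative (grad \<phi>) (at x) v - H v"
  have u: "(?u has_derivative (\<lambda>v. ?G y \<bullet> v)) (at y)" if "y \<in> S" for y
    by (rule has_derivative_eq_rhs,
        (rule derivative_eq_intros C2D assms g that refl)+)
       (simp add: inner_diff_left)
  have G': "(?G has_derivative ?H) (at x)"
    by (rule has_derivative_eq_rhs,
        (rule derivative_eq_intros C2D assms refl)+) simp
  have "?G x = 0" "(\<Sum>b\<in>Basis. ?H b \<bullet> b) \<le> 0"
    using local_max_second_order[of S x ?u ?G ?H] u G' assms(3,4) max by auto
  then show "grad \<psi> x = \<rho> *\<^sub>R grad \<phi> x + G x"
    and "laplacian \<psi> x \<le> \<rho> * laplacian \<phi> x + (\<Sum>b\<in>Basis. H b \<bullet> b)"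
    by (simp_all add: laplacian_def inner_diff_left sum_subtractf sum_distrib_left sum.distrib algebra_simps)
qed

section \<open>Comparison with multiples of a solution\<close>

text \<open>
  The convexity of \<open>x powr \<theta>\<close> including the endpoint \<open>0\<close>, where it reduces to \<open>u powr \<theta> \<le> u\<close>.
\<close>

lemma powr_convex_nonneg:
  fixes x y u \<theta> :: real
  assumes "\<theta> \<ge> 1" "x \<ge> 0" "y \<ge> 0" "0 \<le> u" "u \<le> 1"
  shows "((1 - u) * x + u * y) powr \<theta> \<le> (1 - u) * x powr \<theta> + u * y powr \<theta>"
proof -
  have le: "c powr \<theta> \<le> c" if "0 \<le> c" "c \<le> 1" for c :: real
    using powr_mono'[of 1 \<theta> c] that assms by simp
  consider "x = 0" | "y = 0" | "x > 0" "y > 0" using assms by linarith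
  then show ?thesis
  proof cases
    case 1
    then show ?thesis using assms le[of u] by (simp add: powr_mult mult_right_mono)
  next
    case 2
    then show ?thesis using assms le[of "1 - u"] by (simp add: powr_mult mult_right_mono)
  next
    case 3
    then show ?thesis
      using convex_onD[OF powr_convex[OF assms(1)], of u x y] assms by simp
  qed
qed

text \<open>
  Convexity applied to \<open>p = (1/\<rho>) * (\<rho> p + e) + (1 - 1/\<rho>) * (- e / (\<rho> - 1))\<close>. The term
  \<open>|\<rho> p + e|\<^sup>\<theta>\<close> carries the coefficient \<open>1\<close>, so a perturbation \<open>e\<close> of the gradient costs
  only a multiple of \<open>|e|\<^sup>\<theta>\<close>, however large \<open>p\<close> is.
\<close>

lemma powr_norm_convex_split:
  fixes p e :: "'a::real_normed_vector"
  assumes "\<theta> \<ge> 1" "\<rho> > 1"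
  shows "\<rho> * norm p powr \<theta>
    \<le> norm (\<rho> *\<^sub>R p + e) powr \<theta> + (\<rho> - 1) powr (1 - \<theta>) * norm e powr \<theta>"
proof -
  define a where "a = norm (\<rho> *\<^sub>R p + e)"
  define b where "b = norm e / (\<rho> - 1)"
  have "\<rho> * norm p = norm (\<rho> *\<^sub>R p + e - e)" using assms by simp
  also have "\<dots> \<le> a + norm e" unfolding a_def by (rule norm_triangle_ineq4)
  finally have "norm p \<le> (a + norm e) / \<rho>" using assms by (simp add: field_simps)
  also have "\<dots> = (1 - (1 - 1/\<rho>)) * a + (1 - 1/\<rho>) * b"
    using assms by (simp add: b_def field_simps)
  finally have "norm p powr \<theta> \<le> ((1 - (1 - 1/\<rho>)) * a + (1 - 1/\<rho>) * b) powr \<theta>"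
    using assms by (intro powr_mono2) auto
  also have "\<dots> \<le> (1 - (1 - 1/\<rho>)) * a powr \<theta> + (1 - 1/\<rho>) * b powr \<theta>"
    using assms by (intro powr_convex_nonneg) (auto simp: a_def b_def)
  finally have "\<rho> * norm p powr \<theta> \<le> \<rho> * ((1/\<rho>) * a powr \<theta> + (1 - 1/\<rho>) * b powr \<theta>)"
    using assms by simp
  also have "\<dots> = a powr \<theta> + (\<rho> - 1) * b powr \<theta>"
    using assms by (simp add: field_simps)
  also have "(\<rho> - 1) * b powr \<theta> = (\<rho> - 1) powr (1 - \<theta>) * norm e powr \<theta>"
    using assms by (simp add: b_def powr_divide powr_diff)
  finally show ?thesis by (simp add: a_def)
qed


text \<open>
  Maximise \<open>\<psi> - \<rho> * \<phi> - a * |y - x0|\<^sup>2\<close> on the closed ball. If the conclusion failed, the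
  value at the centre would exceed all boundary values, so the maximum would be interior; there
  the equations, and \<open>powr_norm_convex_split\<close> with \<open>e\<close> the gradient of the paraboloid, contradict
  the gap assumption. The last two terms of that assumption are the costs of the paraboloid in
  the Laplacian and in the gradient term.
\<close>

lemma ball_comparison:
  fixes \<phi> \<psi> f :: "'a::euclidean_space \<Rightarrow> real"
  assumes \<theta>: "\<theta> > 1" and \<rho>: "\<rho> > 1" and a: "a \<ge> 0" and R: "R > 0"
    and \<psi>: "C2 \<psi>" "\<And>y. y \<in> ball x0 R \<Longrightarrow>
        - (1/2) * laplacian \<psi> y + (1/\<theta>) * norm (grad \<psi> y) powr \<theta> \<le> f y - \<mu>"
    and \<phi>: "EP_solution \<theta> f lam \<phi>"
    and B: "\<And>y. y \<in> cball x0 R \<Longrightarrow> \<psi> y - \<rho> * \<phi> y \<le> B"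
    and F: "\<And>y. y \<in> ball x0 R \<Longrightarrow> F \<le> f y"
    and gap: "(\<rho> - 1) * F > \<rho> * lam - \<mu> + a * real DIM('a)
        + (\<rho> - 1) powr (1 - \<theta>) * (2 * a * R) powr \<theta> / \<theta>"
  shows "\<psi> x0 - \<rho> * \<phi> x0 \<le> B - a * R^2"
proof (rule ccontr)
  assume neg: "\<not> ?thesis"
  have \<phi>C: "C2 \<phi>" and \<phi>eq: "- (1/2) * laplacian \<phi> y + (1/\<theta>) * norm (grad \<phi> y) powr \<theta> = f y - lam" for y
    using \<phi> by (auto simp: EP_solution_def)
  let ?g = "\<lambda>y. a * (norm (y - x0))^2"
  let ?w = "\<lambda>y. \<psi> y - \<rho> * \<phi> y - ?g y"
  have "\<exists>x\<in>cball x0 R. \<forall>y\<in>cball x0 R. ?w y \<le> ?w x"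
    using R by (intro continuous_attains_sup continuous_intros C2D \<psi> \<phi>C) auto
  then obtain x where x: "x \<in> cball x0 R" "\<And>y. y \<in> cball x0 R \<Longrightarrow> ?w y \<le> ?w x"
    by blast
  have xb: "x \<in> ball x0 R"
  proof (rule ccontr)
    assume "x \<notin> ball x0 R"
    then have "norm (x - x0) = R" using x(1) by (simp add: dist_norm norm_minus_commute)
    then show False using x(2)[of x0] B[OF x(1)] neg R by simp
  qed
  define e where "e = (2 * a) *\<^sub>R (x - x0)"
  have g: "(?g has_derivative (\<lambda>v. ((2 * a) *\<^sub>R (y - x0)) \<bullet> v)) (at y)" for y
    unfolding power2_norm_eq_inner
    by (auto intro!: derivative_eq_intros simp: inner_commute algebra_simps)
  have G: "((\<lambda>y. (2 * a) *\<^sub>R (y - x0)) has_derivative (\<lambda>v. (2 * a) *\<^sub>R v)) (at x)"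
    by (auto intro!: derivative_eq_intros)
  have max: "?w y \<le> ?w x" if "y \<in> ball x0 R" for y
    using x(2) that by auto
  note test = C2_local_max_test[OF \<psi>(1) \<phi>C open_ball xb g G max]
  have gr: "grad \<psi> x = \<rho> *\<^sub>R grad \<phi> x + e"
    using test(1) by (simp add: e_def)
  have lap: "laplacian \<psi> x \<le> \<rho> * laplacian \<phi> x + 2 * a * real DIM('a)"
    using test(2) by (simp add: mult.commute)
  have e: "norm e powr \<theta> \<le> (2 * a * R) powr \<theta>"
    using xb a \<theta> by (intro powr_mono2) (auto simp: e_def dist_norm norm_minus_commute intro!: mult_left_mono)
  have "\<rho> * norm (grad \<phi> x) powr \<theta>
      \<le> norm (grad \<psi> x) powr \<theta> + (\<rho> - 1) powr (1 - \<theta>) * norm e powr \<theta>"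
    unfolding gr using \<theta> \<rho> by (intro powr_norm_convex_split) auto
  also have "\<dots> \<le> norm (grad \<psi> x) powr \<theta> + (\<rho> - 1) powr (1 - \<theta>) * (2 * a * R) powr \<theta>"
    using e by (simp add: mult_left_mono)
  finally have "(\<rho> * norm (grad \<phi> x) powr \<theta>) / \<theta>
      \<le> (norm (grad \<psi> x) powr \<theta> + (\<rho> - 1) powr (1 - \<theta>) * (2 * a * R) powr \<theta>) / \<theta>"
    using \<theta> by (simp add: divide_right_mono)
  then have p: "\<rho> * (norm (grad \<phi> x) powr \<theta> / \<theta>) \<le> norm (grad \<psi> x) powr \<theta> / \<theta>
      + (\<rho> - 1) powr (1 - \<theta>) * (2 * a * R) powr \<theta> / \<theta>"
    by (simp add: add_divide_distrib)
  have "\<rho> * (- (1/2) * laplacian \<phi> x + (1/\<theta>) * norm (grad \<phi> x) powr \<theta>) = \<rho> * (f x - lam)"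
    using \<phi>eq[of x] by simp
  moreover have "(\<rho> - 1) * F \<le> (\<rho> - 1) * f x"
    using F[OF xb] \<rho> by simp
  ultimately show False
    using p lap gap \<psi>(2)[OF xb] by (simp add: algebra_simps)
qed

text \<open>
  At a maximum of \<open>\<psi> - \<rho> * \<phi>\<close> the gradients satisfy \<open>D\<psi> = \<rho> * D\<phi>\<close>, and \<open>\<rho> powr \<theta> \<ge> \<rho>\<close>
  lets the equation for \<open>\<phi>\<close>, multiplied by \<open>\<rho>\<close>, be subtracted.
\<close>

lemma touching_level_bound:
  assumes \<rho>: "\<rho> \<ge> 1" and \<theta>: "\<theta> > 1"
    and \<psi>: "EP_subsolution \<theta> f \<mu> \<psi>" and \<phi>: "EP_solution \<theta> f lam \<phi>"
    and max: "\<And>y. \<psi> y - \<rho> * \<phi> y \<le> \<psi> x - \<rho> * \<phi> x"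
  shows "(\<rho> - 1) * f x \<le> \<rho> * lam - \<mu>"
proof -
  have C: "C2 \<psi>" "C2 \<phi>"
    using \<psi> \<phi> by (auto simp: EP_solution_def EP_subsolution_def)
  have 0: "((\<lambda>y. 0) has_derivative (\<lambda>v. 0 \<bullet> v)) (at y)"
    "((\<lambda>y. 0) has_derivative (\<lambda>v. 0)) (at y)" for y :: 'a
    by simp_all
  have "grad \<psi> x = \<rho> *\<^sub>R grad \<phi> x + 0"
    and lap: "laplacian \<psi> x \<le> \<rho> * laplacian \<phi> x + (\<Sum>b\<in>Basis. (0::'a) \<bullet> b)"
    by (rule C2_local_max_test[OF C open_UNIV UNIV_I 0]; use max in simp)+
  then have "norm (grad \<psi> x) powr \<theta> = \<rho> powr \<theta> * norm (grad \<phi> x) powr \<theta>"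
    using \<rho> by (simp add: powr_mult)
  moreover have "\<rho> * norm (grad \<phi> x) powr \<theta> \<le> \<rho> powr \<theta> * norm (grad \<phi> x) powr \<theta>"
    using powr_mono[of 1 \<theta> \<rho>] \<rho> \<theta> by (intro mult_right_mono) auto
  ultimately have p: "\<rho> * (norm (grad \<phi> x) powr \<theta> / \<theta>) \<le> norm (grad \<psi> x) powr \<theta> / \<theta>"
    using \<theta> by (simp add: divide_right_mono)
  have "- (1/2) * laplacian \<psi> x + (1/\<theta>) * norm (grad \<psi> x) powr \<theta> \<le> f x - \<mu>"
    using \<psi> by (auto simp: EP_subsolution_def)
  moreover have "\<rho> * (- (1/2) * laplacian \<phi> x + (1/\<theta>) * norm (grad \<phi> x) powr \<theta>) = \<rho> * (f x - lam)"
    using \<phi> by (simp add: EP_solution_def)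
  ultimately show ?thesis
    using p lap by (simp add: algebra_simps)
qed


section \<open>Growth at infinity under coercivity\<close>

lemma C2_zero: "C2 (\<lambda>y::'a::euclidean_space. 0)"
  and grad_zero: "grad (\<lambda>y::'a. 0) = (\<lambda>y. 0)"
  and laplacian_zero: "laplacian (\<lambda>y::'a. 0) = (\<lambda>y. 0)"
proof -
  show *: "grad (\<lambda>y::'a. 0) = (\<lambda>y. 0)"
    by (simp add: grad_def frechet_derivative_const fun_eq_iff)
  show "C2 (\<lambda>y::'a. 0)"
    by (simp add: C2_def *)
  show "laplacian (\<lambda>y::'a. 0) = (\<lambda>y. 0)"
    by (simp add: laplacian_def * frechet_derivative_const fun_eq_iff)
qed

text \<open>
  On a unit ball where \<open>f\<close> is large, the function \<open>0\<close> is a subsolution at level \<open>0\<close> and can be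
  compared with \<open>2 * \<phi>\<close>. The curvature \<open>a\<close> of the paraboloid, hence the gain at the centre, may
  be chosen as large as desired if \<open>f\<close> is large enough.
\<close>

lemma solution_tends_to_infinity:
  fixes \<phi> f :: "'a::euclidean_space \<Rightarrow> real"
  assumes \<theta>: "\<theta> > 1" and f: "coercive f"
    and \<phi>: "EP_solution \<theta> f lam \<phi>" and bdd: "bdd_below (range \<phi>)"
  shows "filterlim \<phi> at_top at_infinity"
  unfolding filterlim_at_top
proof
  fix K :: real
  obtain c where c: "\<And>y. c \<le> \<phi> y"
    using bdd by (auto simp: bdd_below_def)
  define a where "a = 2 * \<bar>K\<bar> + 2 * \<bar>c\<bar>"
  define F where "F = \<bar>2 * lam + a * real DIM('a) + (2 * a) powr \<theta> / \<theta>\<bar> + 1"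
  obtain r where r: "\<And>y. norm y \<ge> r \<Longrightarrow> F \<le> f y"
    using f by (auto simp: coercive_def filterlim_at_top eventually_at_infinity)
  have "K \<le> \<phi> x" if "norm x \<ge> r + 1" for x
  proof -
    have F: "F \<le> f y" if "y \<in> ball x 1" for y
    proof (rule r)
      show "r \<le> norm y"
        using that \<open>norm x \<ge> r + 1\<close> norm_triangle_ineq2[of x y] by (simp add: dist_norm)
    qed
    have "0 - 2 * \<phi> x \<le> - 2 * c - a * 1^2"
    proof (rule ball_comparison[where f = f and F = F and \<mu> = 0 and \<psi> = "\<lambda>y. 0"])
      show "- (1/2) * laplacian (\<lambda>y. 0) y + (1/\<theta>) * norm (grad (\<lambda>y. 0) y) powr \<theta> \<le> f y - 0"
        if "y \<in> ball x 1" for y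
        using F[OF that] by (simp add: grad_zero laplacian_zero F_def)
    qed (use \<theta> \<phi> c F in \<open>auto simp: C2_zero a_def F_def\<close>)
    then show ?thesis by (simp add: a_def)
  qed
  then show "\<forall>\<^sub>F x in at_infinity. K \<le> \<phi> x"
    by (auto simp: eventually_at_infinity)
qed

section \<open>The case of at least quadratic growth in the gradient\<close>

text \<open>
  With \<open>q = E * P\<close> both sides compare \<open>(1 - 1/E) * q\<^sup>2 / 2\<close> to
  \<open>(1 - E powr (1 - \<theta>)) * q powr \<theta> / \<theta>\<close>. The hypothesis \<open>\<theta> \<ge> 2\<close> enters twice: it orders the two
  factors in front, and by Young's inequality \<open>q\<^sup>2 / 2 \<le> q powr \<theta> / \<theta> + 1/2\<close>. Here \<open>P\<close> stands for
  \<open>|D\<phi>|\<close> and \<open>E\<close> for \<open>exp (\<psi> - \<phi>)\<close> at a maximum of \<open>exp (- \<phi>) - exp (- \<psi>)\<close>.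
\<close>

lemma exponential_transform_gap:
  fixes E P \<theta> :: real
  assumes \<theta>: "\<theta> \<ge> 2" and E: "E \<ge> 1" and P: "P \<ge> 0"
  shows "(E^2 - E) * P^2 / 2 \<le> (E powr \<theta> - E) * P powr \<theta> / \<theta> + (E - 1) / 2"
proof -
  define q where "q = E * P"
  have q: "q \<ge> 0" using E P by (simp add: q_def)
  have young: "q^2 / 2 \<le> q powr \<theta> / \<theta> + 1/2"
  proof (cases "\<theta> = 2")
    case True
    then show ?thesis using q by (simp add: powr_numeral)
  next
    case False
    have "q^2 * 1 \<le> (q^2) powr (\<theta>/2) / (\<theta>/2) + 1 powr (\<theta>/(\<theta>-2)) / (\<theta>/(\<theta>-2))"
      using \<theta> False by (intro Youngs_inequality) (auto simp: field_simps)
    moreover have "(q^2) powr (\<theta>/2) = q powr \<theta>"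
      using q by (simp add: powr_powr flip: powr_numeral)
    moreover have "1 powr (\<theta>/(\<theta>-2)) / (\<theta>/(\<theta>-2)) \<le> 1"
      using \<theta> by (simp add: field_simps)
    moreover have "q powr \<theta> / (\<theta>/2) = 2 * (q powr \<theta> / \<theta>)"
      by simp
    ultimately show ?thesis by simp
  qed
  have "E powr (1 - \<theta>) \<le> E powr (-1)"
    using E \<theta> by (intro powr_mono) auto
  then have le: "1 - 1/E \<le> 1 - E powr (1 - \<theta>)"
    using E by (simp add: powr_minus_divide)
  have "(E^2 - E) * P^2 / 2 = (1 - 1/E) * (q^2 / 2)"
    using E by (simp add: q_def field_simps power2_eq_square)
  also have "\<dots> \<le> (1 - 1/E) * (q powr \<theta> / \<theta> + 1/2)"
    using young E by (intro mult_left_mono) auto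
  also have "\<dots> = (1 - 1/E) * (q powr \<theta> / \<theta>) + (1 - 1/E) / 2"
    by (simp add: algebra_simps)
  also have "\<dots> \<le> (1 - E powr (1 - \<theta>)) * (q powr \<theta> / \<theta>) + (E - 1) / 2"
  proof (intro add_mono mult_right_mono le divide_right_mono)
    show "1 - 1 / E \<le> E - 1"
      using E sum_squares_ge_zero[of "E - 1" 0] by (simp add: field_simps)
  qed (use \<theta> in auto)
  also have "(1 - E powr (1 - \<theta>)) * (q powr \<theta> / \<theta>) = (E powr \<theta> - E) * P powr \<theta> / \<theta>"
  proof -
    have "E powr (1 - \<theta>) * E powr \<theta> = E"
      using E by (simp flip: powr_add)
    then have "(1 - E powr (1 - \<theta>)) * q powr \<theta> = (E powr \<theta> - E) * P powr \<theta>"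
      using E P by (simp add: q_def powr_mult left_diff_distrib flip: mult.assoc)
    then show ?thesis by simp
  qed
  finally show ?thesis .
qed

text \<open>
  The maximum conditions for \<open>exp (- \<phi>) - exp (- \<psi>)\<close>, multiplied by \<open>exp (\<psi> x)\<close> and rewritten
  for \<open>\<phi>\<close> and \<open>\<psi>\<close> themselves.
\<close>

lemma C2_exp_max_test:
  assumes C: "C2 \<psi>" "C2 \<phi>"
    and max: "\<And>y. exp (- \<phi> y) - exp (- \<psi> y) \<le> exp (- \<phi> x) - exp (- \<psi> x)"
  defines "E \<equiv> exp (\<psi> x - \<phi> x)"
  shows "grad \<psi> x = E *\<^sub>R grad \<phi> x"
    and "laplacian \<psi> x \<le> E * laplacian \<phi> x + (E^2 - E) * (norm (grad \<phi> x))^2"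
proof -
  let ?u = "\<lambda>y. exp (- \<phi> y) - exp (- \<psi> y)"
  let ?G = "\<lambda>y. exp (- \<psi> y) *\<^sub>R grad \<psi> y - exp (- \<phi> y) *\<^sub>R grad \<phi> y"
  let ?H = "\<lambda>v. exp (- \<psi> x) *\<^sub>R (frechet_derivative (grad \<psi>) (at x) v - (grad \<psi> x \<bullet> v) *\<^sub>R grad \<psi> x)
     - exp (- \<phi> x) *\<^sub>R (frechet_derivative (grad \<phi>) (at x) v - (grad \<phi> x \<bullet> v) *\<^sub>R grad \<phi> x)"
  have u: "(?u has_derivative (\<lambda>v. ?G y \<bullet> v)) (at y)" for y
    by (rule has_derivative_eq_rhs,
        (rule derivative_eq_intros C2D C refl)+)
       (simp add: inner_diff_left mult.commute)
  have G: "(?G has_derivative ?H) (at x)"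
    by (rule has_derivative_eq_rhs,
        (rule derivative_eq_intros C2D C refl)+)
       (simp add: algebra_simps)
  have "?G x = 0" and lap: "(\<Sum>b\<in>Basis. ?H b \<bullet> b) \<le> 0"
    using local_max_second_order[of UNIV x ?u ?G ?H] u G max by auto
  then have "exp (\<psi> x) *\<^sub>R (exp (- \<psi> x) *\<^sub>R grad \<psi> x) = exp (\<psi> x) *\<^sub>R (exp (- \<phi> x) *\<^sub>R grad \<phi> x)"
    by simp
  then show gr: "grad \<psi> x = E *\<^sub>R grad \<phi> x"
    by (simp add: E_def flip: exp_add)
  have sq: "(\<Sum>b\<in>Basis. (p \<bullet> b) * (p \<bullet> b)) = (norm p)^2" for p :: 'a
    by (simp add: power2_norm_eq_inner flip: euclidean_inner)
  have "(\<Sum>b\<in>Basis. ?H b \<bullet> b) = exp (- \<psi> x) * (laplacian \<psi> x - (norm (grad \<psi> x))^2)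
      - exp (- \<phi> x) * (laplacian \<phi> x - (norm (grad \<phi> x))^2)"
    by (simp add: inner_diff_left laplacian_def sum_subtractf sum_distrib_left right_diff_distrib flip: sq)
  with lap have "exp (\<psi> x) * (exp (- \<psi> x) * (laplacian \<psi> x - (norm (grad \<psi> x))^2))
      \<le> exp (\<psi> x) * (exp (- \<phi> x) * (laplacian \<phi> x - (norm (grad \<phi> x))^2))"
    by simp
  then have "laplacian \<psi> x - (norm (grad \<psi> x))^2 \<le> E * (laplacian \<phi> x - (norm (grad \<phi> x))^2)"
    by (simp add: E_def flip: mult.assoc exp_add)
  moreover have "(norm (grad \<psi> x))^2 = E^2 * (norm (grad \<phi> x))^2"
    by (simp add: gr power_mult_distrib)
  ultimately show "laplacian \<psi> x \<le> E * laplacian \<phi> x + (E^2 - E) * (norm (grad \<phi> x))^2"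
    by (simp add: algebra_simps)
qed

lemma EP_subsolution_add_const:
  assumes "EP_subsolution \<theta> f \<mu> \<psi>"
  shows "EP_subsolution \<theta> f \<mu> (\<lambda>y. \<psi> y + c)"
proof -
  have C: "C2 \<psi>" using assms by (simp add: EP_subsolution_def)
  have "((\<lambda>y. \<psi> y + c) has_derivative frechet_derivative \<psi> (at y)) (at y)" for y
    using C by (auto simp: C2_def frechet_derivative_works intro!: derivative_eq_intros)
  then have fd: "frechet_derivative (\<lambda>y. \<psi> y + c) (at y) = frechet_derivative \<psi> (at y)"
    and df: "(\<lambda>y. \<psi> y + c) differentiable at y" for y
    by (metis frechet_derivative_at, metis differentiableI)
  have gr: "grad (\<lambda>y. \<psi> y + c) = grad \<psi>"
    by (simp add: grad_def fd fun_eq_iff)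
  show ?thesis
    using assms df by (auto simp: EP_subsolution_def C2_def laplacian_def gr)
qed

text \<open>
  Suppose \<open>\<mu> > lam\<close>. Shift \<open>\<psi>\<close> so that it touches \<open>\<phi>\<close> from below over a ball outside which \<open>f \<ge> lam + 1/2\<close>. The
  exponential comparison shows that the shifted subsolution stays below \<open>\<phi>\<close> everywhere: at a
  positive maximum of \<open>exp (- \<phi>) - exp (- \<psi>')\<close>, which lies outside the ball, the equations give
  \<open>(E - 1) * (f - lam - 1/2) \<le> lam - \<mu> < 0\<close>. So the point of contact in the ball is a global
  maximum of \<open>\<psi> - \<phi>\<close>, and there the equations give \<open>\<mu> \<le> lam\<close>.
\<close>

lemma subsolution_level_le_quadratic:
  fixes f \<phi> \<psi> :: "'a::euclidean_space \<Rightarrow> real"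
  assumes \<theta>: "\<theta> \<ge> 2" and f: "coercive f"
    and \<phi>: "EP_solution \<theta> f lam \<phi>" and bdd: "bdd_below (range \<phi>)"
    and sub: "EP_subsolution \<theta> f \<mu> \<psi>"
  shows "\<mu> \<le> lam"
proof (rule ccontr)
  assume "\<not> \<mu> \<le> lam"
  then have gt: "\<mu> > lam" by simp
  have \<phi>C: "C2 \<phi>" using \<phi> by (simp add: EP_solution_def)
  obtain r where r: "\<And>y. norm y \<ge> r \<Longrightarrow> lam + 1/2 \<le> f y"
    using f by (auto simp: coercive_def filterlim_at_top eventually_at_infinity)
  let ?K = "cball 0 \<bar>r\<bar> :: 'a set"
  have "\<exists>x\<in>?K. \<forall>y\<in>?K. \<psi> y - \<phi> y \<le> \<psi> x - \<phi> x"
    using sub by (intro continuous_attains_sup continuous_intros C2D \<phi>C) (auto simp: EP_subsolution_def)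
  then obtain z where z: "\<And>y. y \<in> ?K \<Longrightarrow> \<psi> y - \<phi> y \<le> \<psi> z - \<phi> z"
    by blast
  define \<psi>' where "\<psi>' = (\<lambda>y. \<psi> y + (\<phi> z - \<psi> z))"
  have \<psi>': "EP_subsolution \<theta> f \<mu> \<psi>'"
    unfolding \<psi>'_def by (rule EP_subsolution_add_const[OF sub])
  then have \<psi>'C: "C2 \<psi>'" by (simp add: EP_subsolution_def)
  have \<psi>'K: "\<psi>' y \<le> \<phi> y" if "norm y \<le> \<bar>r\<bar>" for y
    using z[of y] that by (simp add: \<psi>'_def)
  let ?w = "\<lambda>y. exp (- \<phi> y) - exp (- \<psi>' y)"
  have le: "\<psi>' y \<le> \<phi> y" for y
  proof (rule ccontr)
    assume neg: "\<not> \<psi>' y \<le> \<phi> y"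
    define d where "d = ?w y"
    have d: "d > 0" using neg by (simp add: d_def)
    have "filterlim \<phi> at_top at_infinity"
      using \<theta> f \<phi> bdd by (intro solution_tends_to_infinity) auto
    then obtain s where s: "\<And>y. norm y \<ge> s \<Longrightarrow> - ln d \<le> \<phi> y"
      by (auto simp: filterlim_at_top eventually_at_infinity)
    have small: "?w x \<le> d" if "norm x \<ge> s" for x
    proof -
      have "exp (- \<phi> x) \<le> exp (ln d)" using s[OF that] by simp
      then show ?thesis using d by (smt (verit) exp_ln exp_gt_zero)
    qed
    let ?D = "cball 0 (max \<bar>s\<bar> (norm y)) :: 'a set"
    have "\<exists>x\<in>?D. \<forall>y\<in>?D. ?w y \<le> ?w x"
      by (intro continuous_attains_sup continuous_intros C2D \<phi>C \<psi>'C) auto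
    then obtain x where x: "\<And>y. y \<in> ?D \<Longrightarrow> ?w y \<le> ?w x"
      by blast
    have dx: "d \<le> ?w x"
      unfolding d_def by (rule x) simp
    have max: "?w y' \<le> ?w x" for y'
    proof (cases "y' \<in> ?D")
      case False
      then have "norm y' \<ge> s" by auto
      then show ?thesis using small dx by force
    qed (use x in auto)
    have gtx: "\<phi> x < \<psi>' x" using d dx by (smt (verit) exp_less_cancel_iff)
    then have "norm x > \<bar>r\<bar>" using \<psi>'K[of x] by fastforce
    then have fx: "lam + 1/2 \<le> f x" by (intro r) auto
    define E where "E = exp (\<psi>' x - \<phi> x)"
    have E: "E > 1" using gtx by (simp add: E_def)
    define P where "P = norm (grad \<phi> x)"
    have gr: "grad \<psi>' x = E *\<^sub>R grad \<phi> x"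
      and lap: "laplacian \<psi>' x \<le> E * laplacian \<phi> x + (E^2 - E) * P^2"
      using C2_exp_max_test[OF \<psi>'C \<phi>C max] by (simp_all add: E_def P_def)
    have "norm (grad \<psi>' x) powr \<theta> = E powr \<theta> * P powr \<theta>"
      using E by (simp add: gr powr_mult P_def)
    then have "- (1/2) * laplacian \<psi>' x + E powr \<theta> * P powr \<theta> / \<theta> \<le> f x - \<mu>"
      using \<psi>' by (auto simp: EP_subsolution_def dest: spec[of _ x])
    moreover have "E * (- (1/2) * laplacian \<phi> x + P powr \<theta> / \<theta>) = E * (f x - lam)"
      using \<phi> by (simp add: EP_solution_def P_def)
    then have "- (1/2) * (E * laplacian \<phi> x) + E * (P powr \<theta> / \<theta>) = E * f x - E * lam"
      by (simp only: right_diff_distrib distrib_left mult.left_commute)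
    moreover have "(E^2 - E) * P^2 / 2 \<le> (E powr \<theta> - E) * P powr \<theta> / \<theta> + (E - 1) / 2"
      using E \<theta> by (intro exponential_transform_gap) (auto simp: P_def)
    then have "(E^2 - E) * P^2 / 2
        \<le> E powr \<theta> * P powr \<theta> / \<theta> - E * (P powr \<theta> / \<theta>) + (E - 1) / 2"
      by (simp add: left_diff_distrib diff_divide_distrib)
    moreover have "(E - 1) * (lam + 1/2) \<le> (E - 1) * f x"
      using E fx by simp
    then have "E * lam - lam + (E - 1) / 2 \<le> E * f x - f x"
      by (simp add: algebra_simps diff_divide_distrib)
    ultimately show False
      using lap gt by linarith
  qed
  have "(1 - 1) * f z \<le> 1 * lam - \<mu>"
    by (rule touching_level_bound[OF _ _ \<psi>' \<phi>]) (use \<theta> le in \<open>auto simp: \<psi>'_def algebra_simps\<close>)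
  then show False using gt by simp
qed


section \<open>Upper growth of subsolutions below quadratic gradient growth\<close>

lemma has_derivative_radial:
  fixes x :: "'a::euclidean_space"
  assumes x: "x \<noteq> 0" and F: "(F has_real_derivative F1 (norm x)) (at (norm x))"
  shows "((\<lambda>y. F (norm y)) has_derivative (\<lambda>v. ((F1 (norm x) / norm x) *\<^sub>R x) \<bullet> v)) (at x)"
proof -
  have "(norm has_derivative (\<lambda>v. sgn x \<bullet> v)) (at x)"
    using has_derivative_norm[OF x] by (simp add: inner_commute)
  from has_derivative_compose[OF this F[unfolded has_field_derivative_def]]
  show ?thesis
    by (simp add: sgn_div_norm field_simps)
qed

lemma radial_hessian:
  fixes x :: "'a::euclidean_space"
  assumes x: "x \<noteq> 0" and F1: "(F1 has_real_derivative d) (at (norm x))"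
  obtains H where "((\<lambda>y. (F1 (norm y) / norm y) *\<^sub>R y) has_derivative H) (at x)"
    and "(\<Sum>b\<in>Basis. H b \<bullet> b) = (real DIM('a) - 1) * (F1 (norm x) / norm x) + d"
proof -
  let ?r = "norm x"
  define c where "c = (d * ?r - F1 ?r) / ?r^2"
  let ?H = "\<lambda>v. (F1 ?r / ?r) *\<^sub>R v + (((c / ?r) *\<^sub>R x) \<bullet> v) *\<^sub>R x"
  have q: "((\<lambda>r. F1 r / r) has_real_derivative c) (at ?r)"
    using x by (auto intro!: derivative_eq_intros F1 simp: c_def power2_eq_square)
  have "((\<lambda>y. F1 (norm y) / norm y) has_derivative (\<lambda>v. ((c / ?r) *\<^sub>R x) \<bullet> v)) (at x)"
    by (rule has_derivative_radial[OF x, of "\<lambda>r. F1 r / r" "\<lambda>_. c"]) (rule q)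
  from has_derivative_scaleR[OF this has_derivative_ident]
  have "((\<lambda>y. (F1 (norm y) / norm y) *\<^sub>R y) has_derivative ?H) (at x)"
    by simp
  moreover have "(\<Sum>b\<in>Basis. ?H b \<bullet> b) = (real DIM('a) - 1) * (F1 ?r / ?r) + d"
  proof -
    have "(\<Sum>b\<in>Basis. ?H b \<bullet> b)
        = (\<Sum>b\<in>(Basis :: 'a set). F1 ?r / ?r * (b \<bullet> b)) + (\<Sum>b\<in>Basis. c / ?r * ((x \<bullet> b) * (x \<bullet> b)))"
      by (simp add: inner_add_left sum.distrib mult.assoc)
    also have "\<dots> = real DIM('a) * (F1 ?r / ?r) + c / ?r * ?r^2"
      by (simp add: power2_norm_eq_inner euclidean_inner[of x x] sum_distrib_left sum_divide_distrib)
    also have "c / ?r * ?r^2 = d - F1 ?r / ?r"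
      using x by (simp add: c_def field_simps power2_eq_square)
    finally show ?thesis by (simp only: left_diff_distrib)
  qed
  ultimately show thesis by (rule that)
qed

text \<open>
  The radial barrier of \<open>subsolution_growth\<close> has the profile \<open>w s = A * (s + (2 - s) powr (- \<beta>))\<close>.
  With \<open>X = (2 - s) powr (- (\<beta> + 1))\<close> one has \<open>w' = A * (1 + \<beta> * X)\<close> and
  \<open>w'' = A * \<beta> * (\<beta> + 1) * X powr \<theta>\<close>. All terms on the left are at most linear in \<open>A\<close>, and are
  dominated by \<open>(1 + \<beta> * X) powr \<theta>\<close> in \<open>X\<close>; the right side has the higher order \<open>A powr \<theta>\<close>.
\<close>

lemma barrier_amplitude:
  fixes \<theta> \<beta> C d :: real
  assumes \<theta>: "\<theta> > 1" and \<beta>: "\<beta> > 0" and C: "C \<ge> 0" and d: "d \<ge> 0"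
  obtains A where "A \<ge> 1"
    and "\<And>X. X \<ge> 0 \<Longrightarrow> C + (A * \<beta> * (\<beta> + 1) * X powr \<theta>) / 2 + d * (A * (1 + \<beta> * X)) / 2
          < (A * (1 + \<beta> * X)) powr \<theta> / \<theta>"
proof -
  define k where "k = \<beta> powr (1 - \<theta>) * (\<beta> + 1)"
  define K where "K = \<theta> * (C + 1 + k + d)"
  define A where "A = max 1 (K powr (1 / (\<theta> - 1)))"
  have k: "k \<ge> 0" using \<beta> by (simp add: k_def)
  have K: "K > 0" using C d k \<theta> by (simp add: K_def)
  have A: "A \<ge> 1" by (simp add: A_def)
  have "K = (K powr (1 / (\<theta> - 1))) powr (\<theta> - 1)"
    using K \<theta> by (simp add: powr_powr)
  also have "\<dots> \<le> A powr (\<theta> - 1)"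
    using \<theta> by (intro powr_mono2) (auto simp: A_def)
  finally have AK: "K \<le> A powr (\<theta> - 1)" .
  show thesis
  proof (rule that[OF A])
    fix X :: real assume X: "X \<ge> 0"
    define Y where "Y = 1 + \<beta> * X"
    have Y: "Y \<ge> 1" using \<beta> X by (simp add: Y_def)
    have Y1: "Y powr \<theta> \<ge> Y" using powr_mono[of 1 \<theta> Y] Y \<theta> by simp
    have "\<beta> powr \<theta> * X powr \<theta> \<le> Y powr \<theta>"
      using \<beta> X \<theta> by (auto simp: Y_def simp flip: powr_mult intro!: powr_mono2)
    then have "k * (\<beta> powr \<theta> * X powr \<theta>) \<le> k * Y powr \<theta>"
      using k by (rule mult_left_mono)
    moreover have "k * (\<beta> powr \<theta> * X powr \<theta>) = \<beta> * (\<beta> + 1) * X powr \<theta>"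
    proof -
      have "\<beta> powr (1 - \<theta>) * \<beta> powr \<theta> = \<beta>" using \<beta> by (simp flip: powr_add)
      then show ?thesis by (simp add: k_def mult_ac)
    qed
    ultimately have 1: "\<beta> * (\<beta> + 1) * X powr \<theta> \<le> k * Y powr \<theta>" by simp
    have 2: "d * Y \<le> d * Y powr \<theta>" using Y1 d by (rule mult_left_mono)
    have 3: "C \<le> C * Y powr \<theta>" using Y1 Y C mult_left_mono[of 1 "Y powr \<theta>" C] by simp
    have nonneg: "0 \<le> \<beta> * (\<beta> + 1) * X powr \<theta>" "0 \<le> d * Y"
      using \<beta> d Y by auto
    have "C \<le> A * C" using A C mult_right_mono[of 1 A C] by simp
    then have "C + (A * \<beta> * (\<beta> + 1) * X powr \<theta>) / 2 + d * (A * Y) / 2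
        \<le> A * (C + \<beta> * (\<beta> + 1) * X powr \<theta> / 2 + d * Y / 2)"
      by (simp add: algebra_simps)
    also have "\<dots> < A * ((C + 1 + k + d) * Y powr \<theta>)"
    proof (rule mult_strict_left_mono)
      show "C + \<beta> * (\<beta> + 1) * X powr \<theta> / 2 + d * Y / 2 < (C + 1 + k + d) * Y powr \<theta>"
        using 1 2 3 Y1 Y nonneg unfolding distrib_right by linarith
    qed (use A in auto)
    also have "\<dots> = A * K * Y powr \<theta> / \<theta>"
      using \<theta> by (simp add: K_def)
    also have "\<dots> \<le> A * A powr (\<theta> - 1) * Y powr \<theta> / \<theta>"
      using AK A \<theta> by (intro divide_right_mono mult_right_mono mult_left_mono) auto
    also have "\<dots> = (A * Y) powr \<theta> / \<theta>"
      using A Y by (simp add: powr_mult powr_diff)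
    finally show "C + (A * \<beta> * (\<beta> + 1) * X powr \<theta>) / 2 + d * (A * (1 + \<beta> * X)) / 2
          < (A * (1 + \<beta> * X)) powr \<theta> / \<theta>"
      by (simp add: Y_def)
  qed
qed

text \<open>
  For \<open>|x| = R \<ge> 1\<close> compare \<open>\<psi>\<close> on the annulus \<open>1 < |y| < 2 * R\<close> with
  \<open>M + R powr \<gamma> * w (|y| / R)\<close>, where \<open>w\<close> is the profile above and \<open>M\<close> bounds \<open>\<psi>\<close> on the unit
  ball. The barrier lies above \<open>\<psi>\<close> on the inner sphere by the choice of \<open>M\<close>, and near the outer
  sphere because it blows up there. The exponent \<open>\<beta> = (2 - \<theta>) / (\<theta> - 1)\<close> makes \<open>w''\<close> and
  \<open>w' powr \<theta>\<close> blow up at the same rate; it is positive just when \<open>\<theta> < 2\<close>. Since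
  \<open>(\<gamma> - 1) * \<theta> = \<alpha>\<close>, the gradient term scales like \<open>R powr \<alpha>\<close>, as \<open>f\<close> does, and the Laplacian
  terms scale no faster. The annulus avoids the origin, where the barrier is not differentiable.
\<close>

lemma subsolution_growth:
  fixes f \<psi> :: "'a::euclidean_space \<Rightarrow> real"
  assumes \<theta>: "1 < \<theta>" "\<theta> < 2" and \<alpha>: "\<alpha> > 0" and f0: "f0 > 0"
    and f: "\<And>y. f y \<le> f0 * (norm y powr \<alpha> + 1)"
    and sub: "EP_subsolution \<theta> f \<mu> \<psi>"
  obtains C where "C > 0" "\<And>x. \<psi> x \<le> C * (1 + norm x powr (\<alpha> / \<theta> + 1))"
proof -
  define \<gamma> where "\<gamma> = \<alpha> / \<theta> + 1"
  define \<beta> where "\<beta> = (2 - \<theta>) / (\<theta> - 1)"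
  define m where "m = real DIM('a) - 1"
  define C1 where "C1 = f0 * (2 powr \<alpha> + 1) + \<bar>\<mu>\<bar>"
  have \<psi>C: "C2 \<psi>" using sub by (simp add: EP_subsolution_def)
  have \<beta>: "\<beta> > 0" using \<theta> by (simp add: \<beta>_def)
  have \<beta>\<theta>: "(\<beta> + 1) * \<theta> = \<beta> + 2" using \<theta> by (simp add: \<beta>_def field_simps)
  have m: "m \<ge> 0" by (simp add: m_def)
  have C1: "C1 \<ge> 0" using f0 by (simp add: C1_def)
  have "\<alpha> / \<theta> \<le> \<alpha>" using \<theta> \<alpha> by (simp add: field_simps)
  then have \<gamma>: "\<gamma> > 1" "\<gamma> - 1 \<le> \<alpha>" "\<gamma> - 2 \<le> \<alpha>" "(\<gamma> - 1) * \<theta> = \<alpha>"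
    using \<theta> \<alpha> by (simp_all add: \<gamma>_def)
  obtain A where A: "A \<ge> 1"
    and amp: "\<And>X. X \<ge> 0 \<Longrightarrow> C1 + (A * \<beta> * (\<beta> + 1) * X powr \<theta>) / 2 + m * (A * (1 + \<beta> * X)) / 2
          < (A * (1 + \<beta> * X)) powr \<theta> / \<theta>"
    using barrier_amplitude[OF \<theta>(1) \<beta> C1 m] by blast
  have bound: "\<exists>N\<ge>0. \<forall>y\<in>cball 0 r. \<psi> y \<le> N" for r
  proof -
    have "bounded (\<psi> ` cball 0 r)"
      by (intro compact_imp_bounded compact_continuous_image C2D \<psi>C compact_cball)
    then obtain N where "N > 0" "\<forall>y\<in>cball 0 r. \<bar>\<psi> y\<bar> \<le> N"
      by (auto simp: bounded_pos)
    then show ?thesis by (intro exI[of _ N]) auto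
  qed
  from bound[of 1] obtain M where M: "M \<ge> 0" "\<And>y. norm y \<le> 1 \<Longrightarrow> \<psi> y \<le> M"
    by auto
  have main: "\<psi> x \<le> M + norm x powr \<gamma> * (2 * A)" if "norm x \<ge> 1" for x
  proof (rule ccontr)
    assume neg: "\<not> ?thesis"
    define R where "R = norm x"
    have R: "R \<ge> 1" using that by (simp add: R_def)
    from bound[of "2 * R"] obtain N where N: "N \<ge> 0" "\<And>y. norm y \<le> 2 * R \<Longrightarrow> \<psi> y \<le> N"
      by auto
    \<comment> \<open>At \<open>s = 2 - \<delta>\<close> the singular part of the profile equals \<open>N + 1\<close>, so the barrier exceeds
      \<open>\<psi>\<close> on the sphere of radius \<open>(2 - \<delta>) * R\<close>.\<close>
    define \<delta> where "\<delta> = (N + 1) powr (- (1 / \<beta>))"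
    have "\<delta> \<le> (N + 1) powr 0"
      unfolding \<delta>_def using N \<beta> by (intro powr_mono) auto
    then have \<delta>: "0 < \<delta>" "\<delta> \<le> 1" "\<delta> powr (- \<beta>) = N + 1"
      using N \<beta> by (auto simp: \<delta>_def powr_powr)
    let ?X = "\<lambda>r. (2 - r / R) powr (- (\<beta> + 1))"
    define F where "F = (\<lambda>r. M + R powr \<gamma> * (A * (r / R + (2 - r / R) powr (- \<beta>))))"
    define F1 where "F1 = (\<lambda>r. R powr (\<gamma> - 1) * (A * (1 + \<beta> * ?X r)))"
    define F2 where "F2 = (\<lambda>r. R powr (\<gamma> - 2) * (A * \<beta> * (\<beta> + 1) * ?X r powr \<theta>))"
    have R\<gamma>: "R powr \<gamma> = R * R powr (\<gamma> - 1)" "R powr (\<gamma> - 1) = R * R powr (\<gamma> - 2)"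
      using R by (simp_all add: powr_mult_base)
    have R0: "R \<noteq> 0" using R by simp
    have pw: "((\<lambda>r. (2 - r / R) powr q) has_real_derivative - q / R * (2 - r / R) powr (q - 1)) (at r)"
      if "r < 2 * R" for q r
    proof -
      have "2 - r / R > 0" using that R by (simp add: field_simps)
      moreover have "((\<lambda>r. 2 - r / R) has_real_derivative - 1 / R) (at r)"
        using R by (auto intro!: derivative_eq_intros)
      ultimately show ?thesis
        using DERIV_fun_powr[of "\<lambda>r. 2 - r / R" "- 1 / R" r q] by (simp add: mult.commute)
    qed
    have dF: "(F has_real_derivative F1 r) (at r)" if "r < 2 * R" for r
    proof -
      have "(F has_real_derivative
          R powr \<gamma> * (A * (1 / R + - (- \<beta>) / R * (2 - r / R) powr (- \<beta> - 1)))) (at r)"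
        unfolding F_def
        by (rule DERIV_cong, (rule derivative_intros pw that R0)+) simp
      moreover have "R powr \<gamma> * (A * (1 / R + - (- \<beta>) / R * Q)) = R powr (\<gamma> - 1) * (A * (1 + \<beta> * Q))" for Q
        unfolding R\<gamma>(1) using R by (simp add: distrib_left)
      moreover have "- \<beta> - 1 = - (\<beta> + 1)" by simp
      ultimately show ?thesis by (simp only: F1_def)
    qed
    have dF1: "(F1 has_real_derivative F2 r) (at r)" if "r < 2 * R" for r
    proof -
      have "- (\<beta> + 1) * \<theta> = - (\<beta> + 1) - 1" using \<beta>\<theta> by (simp add: minus_mult_left[symmetric] del: minus_add_distrib)
      then have X: "?X r powr \<theta> = (2 - r / R) powr (- (\<beta> + 1) - 1)"
        by (simp only: powr_powr)
      have "(F1 has_real_derivative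
          R powr (\<gamma> - 1) * (A * (\<beta> * (- (- (\<beta> + 1)) / R * (2 - r / R) powr (- (\<beta> + 1) - 1))))) (at r)"
        unfolding F1_def
        by (rule DERIV_cong, (rule derivative_intros pw that R0)+) simp
      moreover have "R powr (\<gamma> - 1) * (A * (\<beta> * (- (- (\<beta> + 1)) / R * Q)))
          = R powr (\<gamma> - 2) * (A * \<beta> * (\<beta> + 1) * Q)" for Q
        unfolding R\<gamma>(2) using R by simp
      ultimately show ?thesis by (simp only: F2_def X)
    qed
    define Z where "Z = (2 - \<delta>) * R"
    have Z: "R \<le> Z" "Z < 2 * R" "Z / R = 2 - \<delta>"
      using \<delta> R by (auto simp: Z_def)
    let ?W = "\<lambda>y::'a. F (norm y)"
    let ?D = "{y::'a. 1 \<le> norm y \<and> norm y \<le> Z}"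
    have D0: "y \<noteq> 0" "norm y < 2 * R" if "y \<in> ?D" for y
      using that Z by auto
    have "isCont ?W y" if "y \<in> ?D" for y
      using has_derivative_radial[of y F F1] dF D0[OF that] by (auto intro: has_derivative_continuous)
    then have "continuous_on ?D ?W"
      by (simp add: continuous_at_imp_continuous_on)
    moreover have "compact ?D"
    proof -
      have "?D = cball 0 Z - ball 0 1" by (auto simp: not_less)
      then show ?thesis by (simp add: compact_diff)
    qed
    moreover have xD: "x \<in> ?D" using R Z by (simp add: R_def)
    ultimately have "\<exists>z\<in>?D. \<forall>y\<in>?D. \<psi> y - ?W y \<le> \<psi> z - ?W z"
      by (intro continuous_attains_sup continuous_on_diff C2D(3)[OF \<psi>C]) auto
    then obtain z where z: "z \<in> ?D" "\<And>y. y \<in> ?D \<Longrightarrow> \<psi> y - ?W y \<le> \<psi> z - ?W z"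
      by blast
    have "?W x = M + norm x powr \<gamma> * (2 * A)"
      using R by (simp add: F_def R_def[symmetric])
    then have above: "?W z < \<psi> z" using z(2)[OF xD] neg by simp
    have R1: "R powr \<gamma> \<ge> 1" using R \<gamma> by (simp add: ge_one_powr_ge_zero)
    have "norm z \<noteq> 1"
    proof
      assume "norm z = 1"
      then have "?W z \<ge> M" using R A by (simp add: F_def)
      moreover have "\<psi> z \<le> M" using M \<open>norm z = 1\<close> by simp
      ultimately show False using above by simp
    qed
    moreover have "norm z \<noteq> Z"
    proof
      assume nz: "norm z = Z"
      then have "?W z = M + R powr \<gamma> * (A * (2 - \<delta> + (N + 1)))"
        by (simp add: F_def Z \<delta>)
      moreover have "1 * (1 * (N + 1)) \<le> R powr \<gamma> * (A * (2 - \<delta> + (N + 1)))"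
        using R1 A \<delta> N by (intro mult_mono) auto
      moreover have "\<psi> z \<le> N" using N nz Z by simp
      ultimately show False using above M by simp
    qed
    ultimately have zS: "z \<in> {y. 1 < norm y \<and> norm y < Z}" using z(1) by auto
    have op: "open {y::'a. 1 < norm y \<and> norm y < Z}"
      by (intro open_Collect_conj open_Collect_less continuous_intros)
    define r where "r = norm z"
    have r: "1 < r" "r < 2 * R" using zS Z by (auto simp: r_def)
    obtain H where H: "((\<lambda>y. (F1 (norm y) / norm y) *\<^sub>R y) has_derivative H) (at z)"
      "(\<Sum>b\<in>Basis. H b \<bullet> b) = m * (F1 r / r) + F2 r"
    proof (rule radial_hessian[of z F1 "F2 r"])
      show "z \<noteq> 0" using r by (auto simp: r_def)
      show "(F1 has_real_derivative F2 r) (at (norm z))"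
        using dF1[OF r(2)] by (simp add: r_def)
    qed (auto simp: r_def m_def)
    have Wd: "(?W has_derivative (\<lambda>v. ((F1 (norm y) / norm y) *\<^sub>R y) \<bullet> v)) (at y)"
      if "y \<in> {y. 1 < norm y \<and> norm y < Z}" for y
      using that Z by (intro has_derivative_radial dF) auto
    \<comment> \<open>The multiplier \<open>\<rho> = 0\<close> compares \<open>\<psi>\<close> with the barrier alone.\<close>
    have max: "\<psi> y - 0 * \<psi> y - ?W y \<le> \<psi> z - 0 * \<psi> z - ?W z"
      if "y \<in> {y. 1 < norm y \<and> norm y < Z}" for y
      using z(2) that by auto
    note test = C2_local_max_test[OF \<psi>C \<psi>C op zS Wd H(1) max]
    define X where "X = ?X r"
    have X: "X \<ge> 0" by (simp add: X_def)
    define w1 where "w1 = A * (1 + \<beta> * X)"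
    have w1: "w1 \<ge> 0" using A \<beta> X by (simp add: w1_def)
    have F1: "F1 r = R powr (\<gamma> - 1) * w1" by (simp add: F1_def w1_def X_def)
    have F1_nonneg: "F1 r \<ge> 0" using w1 by (simp add: F1)
    have "norm (grad \<psi> z) = F1 r"
      using test(1) F1_nonneg r by (simp add: r_def[symmetric])
    also have "\<dots> powr \<theta> = R powr \<alpha> * w1 powr \<theta>"
      using w1 R \<gamma>(4) by (simp add: F1 powr_mult powr_powr)
    finally have gr: "norm (grad \<psi> z) powr \<theta> / \<theta> = R powr \<alpha> * (w1 powr \<theta> / \<theta>)"
      by simp
    have "F1 r / r \<le> F1 r"
      using r F1_nonneg divide_left_mono[of 1 r "F1 r"] by simp
    also have "\<dots> \<le> R powr \<alpha> * w1"
      using \<gamma> R w1 by (auto simp: F1 intro!: mult_right_mono powr_mono)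
    finally have l1: "m * (F1 r / r) \<le> m * (R powr \<alpha> * w1)"
      using m by (rule mult_left_mono)
    have l2: "F2 r \<le> R powr \<alpha> * (A * \<beta> * (\<beta> + 1) * X powr \<theta>)"
      unfolding F2_def X_def using \<gamma> R A \<beta> by (intro mult_right_mono powr_mono) auto
    have lap: "laplacian \<psi> z \<le> m * (R powr \<alpha> * w1) + R powr \<alpha> * (A * \<beta> * (\<beta> + 1) * X powr \<theta>)"
      using test(2) H(2) l1 l2 by simp
    have R\<alpha>: "R powr \<alpha> \<ge> 1" using R \<alpha> by (simp add: ge_one_powr_ge_zero)
    have "f z \<le> f0 * (r powr \<alpha> + 1)" using f[of z] by (simp add: r_def)
    also have "\<dots> \<le> f0 * ((2 * R) powr \<alpha> + R powr \<alpha>)"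
      using r R\<alpha> f0 \<alpha> by (intro mult_left_mono add_mono powr_mono2) auto
    also have "\<dots> = R powr \<alpha> * (f0 * (2 powr \<alpha> + 1))"
      using R by (simp add: powr_mult algebra_simps)
    finally have "f z - \<mu> \<le> R powr \<alpha> * C1"
      using mult_right_mono[OF R\<alpha>, of "\<bar>\<mu>\<bar>"] by (simp add: C1_def distrib_left)
    moreover have "- (1/2) * laplacian \<psi> z + norm (grad \<psi> z) powr \<theta> / \<theta> \<le> f z - \<mu>"
      using sub by (auto simp: EP_subsolution_def)
    moreover have "R powr \<alpha> * (C1 + (A * \<beta> * (\<beta> + 1) * X powr \<theta>) / 2 + m * w1 / 2)
        < R powr \<alpha> * (w1 powr \<theta> / \<theta>)"
      using amp[OF X] R\<alpha> unfolding w1_def by (intro mult_strict_left_mono) auto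
    then have "R powr \<alpha> * C1 + R powr \<alpha> * (A * \<beta> * (\<beta> + 1) * X powr \<theta>) / 2
        + m * (R powr \<alpha> * w1) / 2 < R powr \<alpha> * (w1 powr \<theta> / \<theta>)"
      by (simp only: distrib_left times_divide_eq_right mult.left_commute)
    ultimately show False
      using lap gr by linarith
  qed
  show thesis
  proof (rule that[of "M + 2 * A"])
    show "M + 2 * A > 0" using M A by simp
    show "\<psi> x \<le> (M + 2 * A) * (1 + norm x powr (\<alpha> / \<theta> + 1))" for x
    proof (cases "norm x \<ge> 1")
      case True
      have "0 \<le> M * norm x powr \<gamma>" using M by simp
      then show ?thesis using main[OF True] A by (simp add: \<gamma>_def algebra_simps)
    next
      case False
      have "\<psi> x \<le> M" using M False by simp
      moreover have "0 \<le> (M + 2 * A) * norm x powr \<gamma>" using M A by simp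
      ultimately show ?thesis using A by (simp add: \<gamma>_def algebra_simps)
    qed
  qed
qed


section \<open>The case of subquadratic growth in the gradient\<close>

text \<open>
  Apply \<open>ball_comparison\<close> on the ball of radius \<open>R = |x| / 2\<close> around \<open>x\<close> with
  \<open>a = s * R powr (\<gamma> - 2)\<close>. Both costs of the paraboloid and the margin \<open>(\<rho> - 1) * f\<close> are then of
  order \<open>R powr \<alpha>\<close>, with a small factor \<open>s\<close> in front of the costs. It matters that \<open>\<sigma>\<close> depends on \<open>\<rho>\<close>
  only through the lower bound \<open>1 + \<eta>\<close>; the constant \<open>B'\<close> may depend on everything.
\<close>

lemma comparison_gains_growth:
  fixes f \<phi> :: "'a::euclidean_space \<Rightarrow> real"
  assumes \<theta>: "\<theta> > 1" and \<alpha>: "\<alpha> > 0" and k: "k > 0"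
    and f: "\<And>y. k * norm y powr \<alpha> \<le> f y"
    and \<phi>: "EP_solution \<theta> f lam \<phi>" and \<eta>: "\<eta> > 0"
  obtains \<sigma> where "\<sigma> > 0"
    and "\<And>\<rho> \<mu> \<psi> B. \<lbrakk>\<rho> \<ge> 1 + \<eta>; EP_subsolution \<theta> f \<mu> \<psi>; \<And>y. \<psi> y - \<rho> * \<phi> y \<le> B\<rbrakk>
      \<Longrightarrow> \<exists>B'. \<forall>y. \<psi> y - \<rho> * \<phi> y \<le> B' - \<sigma> * norm y powr (\<alpha> / \<theta> + 1)"
proof -
  define \<gamma> where "\<gamma> = \<alpha> / \<theta> + 1"
  define T where "T = real DIM('a) + \<eta> powr (1 - \<theta>) * 2 powr \<theta>"
  define s where "s = min 1 (\<eta> * k / (2 * T))"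
  have "\<alpha> / \<theta> \<le> \<alpha>" using \<theta> \<alpha> by (simp add: field_simps)
  then have \<gamma>: "\<gamma> > 1" "\<gamma> - 2 \<le> \<alpha>" "(\<gamma> - 1) * \<theta> = \<alpha>"
    using \<theta> \<alpha> by (simp_all add: \<gamma>_def)
  have T: "T > 0" by (simp add: T_def add_pos_nonneg)
  have s: "s > 0" "s \<le> 1" "s * T \<le> \<eta> * k / 2"
    using \<eta> k T by (auto simp: s_def min_def field_simps)
  have s\<theta>: "s powr \<theta> \<le> s"
    using powr_mono'[of 1 \<theta> s] s \<theta> by simp
  define \<sigma> where "\<sigma> = s * 2 powr (- \<gamma>)"
  have \<sigma>: "\<sigma> > 0" using s by (simp add: \<sigma>_def)
  show thesis
  proof (rule that[OF \<sigma>])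
    fix \<rho> \<mu> B and \<psi> :: "'a \<Rightarrow> real"
    assume \<rho>: "\<rho> \<ge> 1 + \<eta>" and \<psi>: "EP_subsolution \<theta> f \<mu> \<psi>"
      and B: "\<And>y. \<psi> y - \<rho> * \<phi> y \<le> B"
    \<comment> \<open>Beyond \<open>R0\<close> half of the margin outweighs the constant \<open>\<rho> * lam - \<mu>\<close>; the other half
      pays for the paraboloid.\<close>
    define L where "L = \<bar>\<rho> * lam - \<mu>\<bar> + 1"
    define R0 where "R0 = max 1 ((2 * L / (\<eta> * k)) powr (1 / \<alpha>))"
    have far: "\<psi> x - \<rho> * \<phi> x \<le> B - \<sigma> * norm x powr \<gamma>" if x: "norm x \<ge> 2 * R0" for x
    proof -
      define R where "R = norm x / 2"
      define a where "a = s * R powr (\<gamma> - 2)"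
      have R: "R \<ge> R0" "R \<ge> 1" using x by (auto simp: R_def R0_def)
      have RR: "R powr (\<gamma> - 2) * R = R powr (\<gamma> - 1)" "R powr (\<gamma> - 2) * R^2 = R powr \<gamma>"
        using R by (simp_all add: powr_diff power2_eq_square powr_numeral)
      have "2 * L / (\<eta> * k) = ((2 * L / (\<eta> * k)) powr (1 / \<alpha>)) powr \<alpha>"
        using \<alpha> \<eta> k by (simp add: powr_powr L_def)
      also have "\<dots> \<le> R powr \<alpha>"
        using R \<alpha> by (intro powr_mono2) (auto simp: R0_def)
      finally have L: "L \<le> \<eta> * k / 2 * R powr \<alpha>"
        using \<eta> k by (simp add: field_simps)
      have a1: "a * real DIM('a) \<le> s * R powr \<alpha> * real DIM('a)"
        unfolding a_def using s R \<gamma> by (intro mult_right_mono mult_left_mono powr_mono) auto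
      have "2 * a * R = 2 * s * R powr (\<gamma> - 1)"
        by (simp add: a_def RR(1)[symmetric])
      then have "(2 * a * R) powr \<theta> = (2 * s * R powr (\<gamma> - 1)) powr \<theta>"
        by (simp only:)
      also have "\<dots> = 2 powr \<theta> * s powr \<theta> * R powr \<alpha>"
        using s R by (simp add: powr_mult powr_powr \<gamma>(3))
      also have "\<dots> \<le> 2 powr \<theta> * s * R powr \<alpha>"
        using s\<theta> by (intro mult_right_mono mult_left_mono) auto
      finally have a2: "(2 * a * R) powr \<theta> \<le> 2 powr \<theta> * s * R powr \<alpha>" .
      have "(\<rho> - 1) powr (1 - \<theta>) \<le> \<eta> powr (1 - \<theta>)"
        using \<rho> \<eta> \<theta> by (intro powr_mono2') auto
      then have "(\<rho> - 1) powr (1 - \<theta>) * (2 * a * R) powr \<theta> / \<theta>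
          \<le> \<eta> powr (1 - \<theta>) * (2 powr \<theta> * s * R powr \<alpha>) / 1"
        using a2 \<theta> s by (intro frac_le mult_mono) auto
      with a1 have "a * real DIM('a) + (\<rho> - 1) powr (1 - \<theta>) * (2 * a * R) powr \<theta> / \<theta>
          \<le> s * R powr \<alpha> * real DIM('a) + \<eta> powr (1 - \<theta>) * (2 powr \<theta> * s * R powr \<alpha>) / 1"
        by (rule add_mono)
      also have "\<dots> = s * T * R powr \<alpha>"
        by (simp add: T_def algebra_simps)
      also have "\<dots> \<le> \<eta> * k / 2 * R powr \<alpha>"
        using s(3) by (rule mult_right_mono) simp
      finally have small: "a * real DIM('a) + (\<rho> - 1) powr (1 - \<theta>) * (2 * a * R) powr \<theta> / \<theta>
          \<le> \<eta> * k / 2 * R powr \<alpha>" .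
      have "\<eta> * (k * R powr \<alpha>) \<le> (\<rho> - 1) * (k * R powr \<alpha>)"
        using \<rho> k by (intro mult_right_mono) auto
      then have big: "\<eta> * k / 2 * R powr \<alpha> + \<eta> * k / 2 * R powr \<alpha> \<le> (\<rho> - 1) * (k * R powr \<alpha>)"
        by (simp add: mult.assoc)
      have "\<psi> x - \<rho> * \<phi> x \<le> B - a * R^2"
      proof (rule ball_comparison[OF \<theta>, where f = f and F = "k * R powr \<alpha>" and \<mu> = \<mu>])
        show "k * R powr \<alpha> \<le> f y" if "y \<in> ball x R" for y
        proof -
          have "R \<le> norm y"
            using that norm_triangle_ineq2[of x y] by (simp add: R_def dist_norm)
          then have "k * R powr \<alpha> \<le> k * norm y powr \<alpha>"
            using k R \<alpha> by (intro mult_left_mono powr_mono2) auto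
          then show ?thesis using f[of y] by simp
        qed
        show "\<rho> * lam - \<mu> + a * real DIM('a)
            + (\<rho> - 1) powr (1 - \<theta>) * (2 * a * R) powr \<theta> / \<theta> < (\<rho> - 1) * (k * R powr \<alpha>)"
          using small big L unfolding L_def by linarith
      qed (use \<rho> \<eta> s R \<psi> \<phi> B in \<open>auto simp: a_def EP_subsolution_def\<close>)
      also have "a * R^2 = s * R powr \<gamma>"
        by (simp add: a_def RR(2)[symmetric])
      also have "\<dots> = \<sigma> * norm x powr \<gamma>"
        by (simp add: R_def \<sigma>_def powr_divide powr_minus_divide)
      finally show ?thesis .
    qed
    have "\<psi> x - \<rho> * \<phi> x \<le> B + \<sigma> * (2 * R0) powr \<gamma> - \<sigma> * norm x powr \<gamma>" for x
    proof (cases "norm x \<ge> 2 * R0")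
      case True
      have "0 \<le> \<sigma> * (2 * R0) powr \<gamma>" using \<sigma> by simp
      then show ?thesis using far[OF True] by simp
    next
      case False
      then have "\<sigma> * norm x powr \<gamma> \<le> \<sigma> * (2 * R0) powr \<gamma>"
        using \<sigma> \<gamma> by (intro mult_left_mono powr_mono2) auto
      then show ?thesis using B[of x] by simp
    qed
    then show "\<exists>B'. \<forall>y. \<psi> y - \<rho> * \<phi> y \<le> B' - \<sigma> * norm y powr (\<alpha> / \<theta> + 1)"
      unfolding \<gamma>_def by blast
  qed
qed

lemma max_attained_of_power_decay:
  fixes w :: "'a::euclidean_space \<Rightarrow> real"
  assumes w: "continuous_on UNIV w" and \<sigma>: "\<sigma> > 0" and \<gamma>: "\<gamma> > 0"
    and decay: "\<And>y. w y \<le> B - \<sigma> * norm y powr \<gamma>"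
  obtains x where "\<And>y. w y \<le> w x"
proof -
  define r where "r = (\<bar>B - w 0\<bar> / \<sigma>) powr (1 / \<gamma>)"
  have r: "r \<ge> 0" by (simp add: r_def)
  have rp: "\<sigma> * r powr \<gamma> = \<bar>B - w 0\<bar>"
    using \<sigma> \<gamma> by (simp add: r_def powr_powr)
  have "\<exists>x\<in>cball 0 r. \<forall>y\<in>cball 0 r. w y \<le> w x"
    using r by (intro continuous_attains_sup continuous_on_subset[OF w]) auto
  then obtain x where "\<forall>y\<in>cball 0 r. w y \<le> w x"
    by blast
  then have x: "w y \<le> w x" if "norm y \<le> r" for y
    using that by simp
  have "w y \<le> w x" for y
  proof (cases "norm y \<le> r")
    case False
    then have "\<sigma> * r powr \<gamma> \<le> \<sigma> * norm y powr \<gamma>"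
      using r \<sigma> \<gamma> by (intro mult_left_mono powr_mono2) auto
    then have "w y \<le> w 0" using decay[of y] rp by linarith
    also have "\<dots> \<le> w x" using x[of 0] r by simp
    finally show ?thesis .
  qed (rule x)
  then show thesis by (rule that)
qed

text \<open>
  Let \<open>S\<close> be the set of \<open>\<rho> > 1\<close> for which \<open>\<psi> - \<rho> * \<phi>\<close> is bounded above; it is closed under
  increasing \<open>\<rho>\<close> because \<open>\<phi>\<close> is bounded below. It is nonempty since \<open>\<phi>\<close> grows at least like
  \<open>|y|\<^sup>\<gamma>\<close> and \<open>\<psi>\<close> at most so. Its infimum is \<open>1\<close>: near a larger infimum the decay gained by
  \<open>comparison_gains_growth\<close> would allow lowering \<open>\<rho>\<close> by a fixed \<open>\<tau>\<close>, because \<open>\<phi>\<close> grows at most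
  like \<open>|y|\<^sup>\<gamma>\<close>.
\<close>

lemma subsolution_level_le_subquadratic:
  fixes f \<phi> \<psi> :: "'a::euclidean_space \<Rightarrow> real"
  assumes \<theta>: "1 < \<theta>" "\<theta> < 2" and \<alpha>: "\<alpha> > 0" and f0: "f0 > 0" and f: "H1 \<alpha> f0 f"
    and \<phi>: "EP_solution \<theta> f lam \<phi>" and bdd: "bdd_below (range \<phi>)"
    and sub: "EP_subsolution \<theta> f \<mu> \<psi>"
  shows "\<mu> \<le> lam"
proof -
  define \<gamma> where "\<gamma> = \<alpha> / \<theta> + 1"
  have \<gamma>: "\<gamma> > 0" using \<theta> \<alpha> by (simp add: \<gamma>_def add_pos_pos)
  have up: "f y \<le> f0 * (norm y powr \<alpha> + 1)" for y
    using f by (simp add: H1_def)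
  have low: "inverse f0 * norm y powr \<alpha> \<le> f y" for y
  proof -
    have "inverse f0 * norm y powr \<alpha> \<le> inverse f0 * (norm y powr \<alpha> + 1)"
      using f0 by (intro mult_left_mono) auto
    also have "\<dots> \<le> f y" using f by (simp add: H1_def)
    finally show ?thesis .
  qed
  have f_nonneg: "f y \<ge> 0" for y
    using low[of y] f0 by (smt (verit) mult_nonneg_nonneg positive_imp_inverse_positive powr_ge_zero)
  have if0: "inverse f0 > 0" using f0 by simp
  obtain c where c: "\<And>y. c \<le> \<phi> y"
    using bdd by (auto simp: bdd_below_def)
  note gain = comparison_gains_growth[OF \<theta>(1) \<alpha> if0 low \<phi>, folded \<gamma>_def]
  have \<phi>sub: "EP_subsolution \<theta> f lam \<phi>"
    using \<phi> by (simp add: EP_solution_def EP_subsolution_def)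
  have C: "C2 \<phi>" "C2 \<psi>"
    using \<phi> sub by (auto simp: EP_solution_def EP_subsolution_def)
  obtain K1 where K1: "K1 > 0" "\<And>y. \<phi> y \<le> K1 * (1 + norm y powr \<gamma>)"
    using subsolution_growth[OF \<theta> \<alpha> f0 up \<phi>sub] unfolding \<gamma>_def by blast
  obtain K2 where K2: "K2 > 0" "\<And>y. \<psi> y \<le> K2 * (1 + norm y powr \<gamma>)"
    using subsolution_growth[OF \<theta> \<alpha> f0 up sub] unfolding \<gamma>_def by blast
  define S where "S = {\<rho>. 1 < \<rho> \<and> (\<exists>B. \<forall>y. \<psi> y - \<rho> * \<phi> y \<le> B)}"
  have up_closed: "\<exists>B. \<forall>y. \<psi> y - \<rho>' * \<phi> y \<le> B"
    if "\<And>y. \<psi> y - \<rho> * \<phi> y \<le> B" "\<rho> \<le> \<rho>'" for \<rho> \<rho>' B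
  proof (intro exI allI)
    fix y
    have "(\<rho>' - \<rho>) * c \<le> (\<rho>' - \<rho>) * \<phi> y"
      using c that(2) by (intro mult_left_mono) auto
    then show "\<psi> y - \<rho>' * \<phi> y \<le> B - (\<rho>' - \<rho>) * c"
      using that(1)[of y] by (simp add: algebra_simps)
  qed
  have "S \<noteq> {}"
  proof -
    obtain \<sigma> where \<sigma>: "\<sigma> > 0" and g: "\<And>\<rho> \<mu> \<psi> B. \<lbrakk>\<rho> \<ge> 1 + 1; EP_subsolution \<theta> f \<mu> \<psi>;
        \<And>y. \<psi> y - \<rho> * \<phi> y \<le> B\<rbrakk> \<Longrightarrow> \<exists>B'. \<forall>y. \<psi> y - \<rho> * \<phi> y \<le> B' - \<sigma> * norm y powr \<gamma>"
      by (rule gain[OF zero_less_one]) blast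
    \<comment> \<open>Comparing the subsolution \<open>0\<close> with \<open>2 * \<phi>\<close> shows that \<open>\<phi>\<close> grows at least like \<open>|y|\<^sup>\<gamma>\<close>.\<close>
    have zero: "EP_subsolution \<theta> f 0 (\<lambda>y. 0)"
      using f_nonneg by (simp add: EP_subsolution_def C2_zero grad_zero laplacian_zero)
    have "\<exists>B'. \<forall>y. 0 - 2 * \<phi> y \<le> B' - \<sigma> * norm y powr \<gamma>"
      by (rule g[OF _ zero, of 2 "- 2 * c"]) (use c in auto)
    then obtain B' where B': "\<And>y. \<sigma> * norm y powr \<gamma> \<le> B' + 2 * \<phi> y"
      by (auto simp: algebra_simps)
    have "\<psi> y - (2 * K2 / \<sigma>) * \<phi> y \<le> K2 + K2 / \<sigma> * B'" for y
    proof -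
      have "K2 / \<sigma> * (\<sigma> * norm y powr \<gamma>) \<le> K2 / \<sigma> * (B' + 2 * \<phi> y)"
        using B' K2(1) \<sigma> by (intro mult_left_mono) auto
      then have "K2 * norm y powr \<gamma> \<le> K2 / \<sigma> * B' + (2 * K2 / \<sigma>) * \<phi> y"
        using \<sigma> by (simp add: distrib_left add_divide_distrib mult_ac)
      then show ?thesis using K2(2)[of y] by (simp add: distrib_left)
    qed
    from up_closed[OF this, of "max 2 (2 * K2 / \<sigma>)"]
    have "max 2 (2 * K2 / \<sigma>) \<in> S" by (simp add: S_def)
    then show ?thesis by blast
  qed
  have bddS: "bdd_below S"
    by (intro bdd_belowI[of _ 1]) (simp add: S_def)
  have inf1: "Inf S \<le> 1"
  proof (rule ccontr)
    assume "\<not> Inf S \<le> 1"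
    then have \<eta>: "Inf S - 1 > 0" by simp
    obtain \<sigma> where \<sigma>: "\<sigma> > 0" and g: "\<And>\<rho> \<mu> \<psi> B. \<lbrakk>\<rho> \<ge> 1 + (Inf S - 1); EP_subsolution \<theta> f \<mu> \<psi>;
        \<And>y. \<psi> y - \<rho> * \<phi> y \<le> B\<rbrakk> \<Longrightarrow> \<exists>B'. \<forall>y. \<psi> y - \<rho> * \<phi> y \<le> B' - \<sigma> * norm y powr \<gamma>"
      by (rule gain[OF \<eta>]) blast
    define \<tau> where "\<tau> = \<sigma> / K1"
    have \<tau>: "\<tau> > 0" using \<sigma> K1 by (simp add: \<tau>_def)
    then obtain \<rho> where \<rho>: "\<rho> \<in> S" "\<rho> < Inf S + \<tau>"
      using \<open>S \<noteq> {}\<close> bddS cInf_less_iff[of S "Inf S + \<tau>"] by auto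
    have \<rho>_ge: "\<rho> \<ge> 1 + (Inf S - 1)" using cInf_lower[OF \<rho>(1) bddS] by simp
    from \<rho>(1) obtain B where "\<And>y. \<psi> y - \<rho> * \<phi> y \<le> B" by (auto simp: S_def)
    from g[OF \<rho>_ge sub this] obtain B' where B': "\<And>y. \<psi> y - \<rho> * \<phi> y \<le> B' - \<sigma> * norm y powr \<gamma>"
      by blast
    have "\<psi> y - (\<rho> - \<tau>) * \<phi> y \<le> B' + \<sigma>" for y
    proof -
      have "\<tau> * \<phi> y \<le> \<tau> * (K1 * (1 + norm y powr \<gamma>))"
        using K1(2) \<tau> by (intro mult_left_mono) auto
      also have "\<dots> = \<sigma> + \<sigma> * norm y powr \<gamma>"
        using K1(1) by (simp add: \<tau>_def distrib_left)
      finally show ?thesis using B'[of y] by (simp add: left_diff_distrib)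
    qed
    from up_closed[OF this, of "max (\<rho> - \<tau>) ((1 + Inf S) / 2)"]
    have "max (\<rho> - \<tau>) ((1 + Inf S) / 2) \<in> S"
      using \<eta> by (simp add: less_max_iff_disj S_def)
    from cInf_lower[OF this bddS] show False
      using \<rho>(2) \<eta> by (auto simp: max_def split: if_splits)
  qed
  have level: "\<mu> \<le> \<rho> * lam" if "\<rho> > 1" for \<rho>
  proof -
    obtain \<rho>' where \<rho>': "\<rho>' \<in> S" "\<rho>' < \<rho>"
      using \<open>S \<noteq> {}\<close> bddS cInf_less_iff[of S \<rho>] le_less_trans[OF inf1 \<open>1 < \<rho>\<close>] by blast
    then obtain B0 where "\<And>y. \<psi> y - \<rho>' * \<phi> y \<le> B0"
      by (auto simp: S_def)
    then obtain B where B: "\<And>y. \<psi> y - \<rho> * \<phi> y \<le> B"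
      using up_closed[of \<rho>' B0 \<rho>] \<rho>'(2) by auto
    have \<eta>: "\<rho> - 1 > 0" using that by simp
    obtain \<sigma> where \<sigma>: "\<sigma> > 0" and g: "\<And>\<rho>' \<mu> \<psi> B. \<lbrakk>\<rho>' \<ge> 1 + (\<rho> - 1); EP_subsolution \<theta> f \<mu> \<psi>;
        \<And>y. \<psi> y - \<rho>' * \<phi> y \<le> B\<rbrakk> \<Longrightarrow> \<exists>B'. \<forall>y. \<psi> y - \<rho>' * \<phi> y \<le> B' - \<sigma> * norm y powr \<gamma>"
      by (rule gain[OF \<eta>]) blast
    obtain B' where B': "\<And>y. \<psi> y - \<rho> * \<phi> y \<le> B' - \<sigma> * norm y powr \<gamma>"
      using g[OF _ sub B] by auto
    have "continuous_on UNIV (\<lambda>y. \<psi> y - \<rho> * \<phi> y)"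
      by (intro continuous_intros C2D C)
    then obtain x where x: "\<And>y. \<psi> y - \<rho> * \<phi> y \<le> \<psi> x - \<rho> * \<phi> x"
      by (rule max_attained_of_power_decay[OF _ \<sigma> \<gamma> B']) blast
    have "(\<rho> - 1) * f x \<le> \<rho> * lam - \<mu>"
      by (rule touching_level_bound[OF _ \<theta>(1) sub \<phi> x]) (use that in simp)
    moreover have "0 \<le> (\<rho> - 1) * f x" using \<eta> f_nonneg[of x] by simp
    ultimately show ?thesis by simp
  qed
  show ?thesis
  proof (rule field_le_epsilon)
    fix e :: real assume e: "e > 0"
    \<comment> \<open>This \<open>\<rho>\<close> makes \<open>(\<rho> - 1) * lam \<le> e\<close>, whatever the sign of \<open>lam\<close>.\<close>
    have "\<mu> \<le> (1 + e / (\<bar>lam\<bar> + 1)) * lam"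
      using e by (intro level) (simp add: divide_pos_pos)
    also have "\<dots> = lam + e * (lam / (\<bar>lam\<bar> + 1))" by (simp add: algebra_simps)
    also have "\<dots> \<le> lam + e"
      using e mult_left_mono[of "lam / (\<bar>lam\<bar> + 1)" 1 e] by (simp add: field_simps)
    finally show "\<mu> \<le> lam + e" .
  qed
qed

section \<open>The level of a solution bounded below\<close>

theorem proposition4p1:
  fixes f \<phi> :: "real ^ 'm \<Rightarrow> real" and \<theta> lam :: real
  assumes "\<theta> > 1"
    and "(\<theta> \<ge> 2 \<and> locally_lipschitz f \<and> coercive f) \<or>
         (\<theta> < 2 \<and> (\<exists>\<alpha>>0. \<exists>f0>0. H0 \<alpha> f0 f \<and> H1 \<alpha> f0 f))"
    and "EP_solution \<theta> f lam \<phi>"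
    and "bdd_below (range \<phi>)"
  shows "ereal lam = lambda_star \<theta> f"
proof -
  have "EP_subsolution \<theta> f lam \<phi>"
    using assms(3) by (simp add: EP_solution_def EP_subsolution_def)
  then have "ereal lam \<le> lambda_star \<theta> f"
    unfolding lambda_star_def by (intro Sup_upper) auto
  moreover have "\<mu> \<le> lam" if "EP_subsolution \<theta> f \<mu> \<psi>" for \<mu> \<psi>
    using assms that subsolution_level_le_quadratic subsolution_level_le_subquadratic by metis
  then have "lambda_star \<theta> f \<le> ereal lam"
    unfolding lambda_star_def by (intro Sup_least) auto
  ultimately show ?thesis by (rule antisym)
qed

end
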